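(* Let $b:\mathbb{R}\to[0,\infty)$ be locally Lipschitz and nondecreasing, let $A,B\ge 0$, and let $g:[0,\infty)\to\mathbb{R}$ be a continuous function such that $$\limsup_{t\to\infty}\ \inf_{0\le h\le 1} g(t+h)=\infty .$$ Then the solution to the integral equation $$X_t=A+Bt+\int_0^t (t-s)\,b(X_s)\,ds+g(t)$$ blows up in finite time if and only if for some $\alpha>0$ and $\beta>0$ $$\int_\alpha^\infty \frac{1}{\left[\beta^2+2\int_\alpha^s b(r)\,dr\right]^{1/2}}\,ds<\infty .$$
   Context: The solution $X$ is the unique continuous solution of the integral equation up to its blow-up time (maximal time of existence); it blows up in finite time if this time is finite. Convention: $1/0=\infty$ in the integrand. *)

theory Defs
  imports "HOL-Analysis.Analysis"
begin

text \<open>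
  A function \<open>X\<close> is only meaningful on \<open>[0, T)\<close>; its values elsewhere are arbitrary.
  The end point \<open>T\<close> is an extended real, so that \<open>T = \<infinity>\<close> stands for a global solution.
\<close>

definition time_interval :: "ereal \<Rightarrow> real set" where
  "time_interval T = {t. 0 \<le> t \<and> ereal t < T}"

definition solves_on ::
  "(real \<Rightarrow> real) \<Rightarrow> real \<Rightarrow> real \<Rightarrow> (real \<Rightarrow> real) \<Rightarrow> ereal \<Rightarrow> (real \<Rightarrow> real) \<Rightarrow> bool" where
  "solves_on b A B g T X \<longleftrightarrow>
     continuous_on (time_interval T) X \<and>
     (\<forall>t\<in>time_interval T.
        X t = A + B * t + integral {0..t} (\<lambda>s. (t - s) * b (X s)) + g t)"

text \<open>
  \<open>X\<close> is a continuous solution on \<open>[0, T)\<close> that no continuous solution on a longer interval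
  extends; \<open>T\<close> is its maximal time of existence.
\<close>

definition maximal_solution ::
  "(real \<Rightarrow> real) \<Rightarrow> real \<Rightarrow> real \<Rightarrow> (real \<Rightarrow> real) \<Rightarrow> ereal \<Rightarrow> (real \<Rightarrow> real) \<Rightarrow> bool" where
  "maximal_solution b A B g T X \<longleftrightarrow>
     0 < T \<and> solves_on b A B g T X \<and>
     (\<nexists>T' Y. T < T' \<and> solves_on b A B g T' Y \<and> (\<forall>t\<in>time_interval T. Y t = X t))"

definition blows_up_in_finite_time :: "ereal \<Rightarrow> bool" where
  "blows_up_in_finite_time T \<longleftrightarrow> T < \<infinity>"

text \<open>
  The quotient is taken in \<^typ>\<open>ennreal\<close>, where \<open>1 / 0 = \<infinity>\<close>.
\<close>

definition osgood_integral :: "(real \<Rightarrow> real) \<Rightarrow> real \<Rightarrow> real \<Rightarrow> ennreal" where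
  "osgood_integral b \<alpha> \<beta> =
     (\<integral>\<^sup>+s\<in>{\<alpha>..}. 1 / ennreal (sqrt (\<beta>\<^sup>2 + 2 * integral {\<alpha>..s} b)) \<partial>lborel)"

end

theory Submission imports Defs
begin

text \<open>
  Write \<open>P t\<close> for the double primitive \<open>\<integral>\<^sub>0\<^sup>t (t - s) b(X s) ds\<close>, so that \<open>P'' = b(X)\<close>.

  If the Osgood integral is finite and \<open>X\<close> were global, choose a late unit interval on which \<open>g\<close>
  exceeds a large \<open>M\<close>; there \<open>X \<ge> M + P\<close>. In the first half of it \<open>P'\<close> gains at least
  \<open>b(M) / 2\<close>, and \<open>b\<close> is unbounded. Hence at midtime \<open>w = R + P - P(mid)\<close> starts at \<open>R\<close> with a
  speed exceeding the square root of the energy \<open>\<beta>\<^sup>2 + 2 \<integral>\<^sub>\<alpha>\<^sup>R b\<close>, and \<open>w'' \<ge> b(w)\<close> as long as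
  \<open>R \<le> M\<close>. So \<open>w\<close> blows up within the tail of the Osgood integral beyond \<open>R\<close>, which is less
  than the remaining half unit of time.

  Conversely, on a bounded time interval \<open>X \<le> C + P\<close> for a constant \<open>C\<close>, so \<open>y = C + P\<close> satisfies
  \<open>y'' \<le> b(y)\<close>; the energy argument bounds the Osgood integral up to \<open>y t\<close> by \<open>t\<close>. If that
  integral diverges, \<open>X\<close> stays bounded and a fixed point argument continues it past \<open>T\<close>.
\<close>

section \<open>Antiderivatives and the Volterra kernel as a double primitive\<close>

text \<open>The domain reaches to the left of \<open>a\<close> without bound, so derivatives at
  \<open>a\<close> itself are two-sided and no one-sided calculus is required at time 0.\<close>

lemma antiderivative_upto:
  fixes c :: "real \<Rightarrow> real" and T :: ereal
  assumes "\<And>x. ereal x < T \<Longrightarrow> isCont c x" and "ereal a < T"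
  obtains Q where "Q a = 0" "\<And>x. ereal x < T \<Longrightarrow> (Q has_real_derivative c x) (at x)"
proof -
  have "- \<infinity> < T" using assms(2) by auto
  then obtain P where P: "\<forall>x. - \<infinity> < ereal x \<longrightarrow> ereal x < T \<longrightarrow> (P has_vector_derivative c x) (at x)"
    using einterval_antiderivative[of "- \<infinity>" T c] assms(1) by blast
  have "((\<lambda>x. P x - P a) has_real_derivative c x) (at x)" if "ereal x < T" for x
    using P that unfolding has_real_derivative_iff_has_vector_derivative
    by (auto intro!: derivative_eq_intros)
  then show ?thesis using that[of "\<lambda>x. P x - P a"] by simp
qed

text \<open>The fundamental theorem of calculus; \<open>max\<close> covers \<open>x < a\<close>,
  where the interval is empty and both sides vanish.\<close>

lemma integral_max_eq:
  fixes P :: "real \<Rightarrow> real"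
  assumes "\<And>y. a \<le> y \<Longrightarrow> y \<le> x \<Longrightarrow> (P has_real_derivative p y) (at y)"
  shows "integral {a..x} p = P (max a x) - P a"
proof (cases "a \<le> x")
  case True
  have "(p has_integral P x - P a) {a..x}"
    by (rule fundamental_theorem_of_calculus)
      (use assms True in \<open>auto intro: DERIV_subset simp flip: has_real_derivative_iff_has_vector_derivative\<close>)
  then show ?thesis using True by (simp add: integral_unique max_absorb2)
qed auto

text \<open>Integration by parts turns the kernel \<open>x - s\<close> into two successive
  primitives, so the integral equation can be handled as a second-order differential
  equation.\<close>

lemma volterra_integral:
  fixes c :: "real \<Rightarrow> real" and T :: ereal
  assumes c: "\<And>x. ereal x < T \<Longrightarrow> isCont c x" and a: "ereal a < T"
  obtains Q S where "Q a = 0" "S a = 0"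
    and "\<And>x. ereal x < T \<Longrightarrow> (Q has_real_derivative c x) (at x)"
    and "\<And>x. ereal x < T \<Longrightarrow> (S has_real_derivative Q x) (at x)"
    and "\<And>x. ereal x < T \<Longrightarrow> integral {a..x} (\<lambda>s. (x - s) * c s) = S (max a x)"
proof -
  obtain Q where Q: "Q a = 0" "\<And>x. ereal x < T \<Longrightarrow> (Q has_real_derivative c x) (at x)"
    using antiderivative_upto[of T c a] c a by blast
  obtain S where S: "S a = 0" "\<And>x. ereal x < T \<Longrightarrow> (S has_real_derivative Q x) (at x)"
    using antiderivative_upto[of T Q a] Q(2) a DERIV_isCont by blast
  have "integral {a..x} (\<lambda>s. (x - s) * c s) = S (max a x)" if "ereal x < T" for x
  proof -
    \<comment> \<open>Differentiating the factor \<open>x - s\<close> contributes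
      \<open>- Q s\<close>, which cancels the derivative of \<open>S\<close>.\<close>
    have "((\<lambda>s. (x - s) * Q s + S s) has_real_derivative (x - y) * c y) (at y)" if "y \<le> x" for y
    proof -
      have "ereal y < T" using \<open>ereal x < T\<close> that
        by (meson ereal_less_eq(3) order_le_less_trans)
      then show ?thesis
        by (auto intro!: derivative_eq_intros Q S)
    qed
    then have "integral {a..x} (\<lambda>s. (x - s) * c s)
        = (x - max a x) * Q (max a x) + S (max a x) - ((x - a) * Q a + S a)"
      by (intro integral_max_eq)
    also have "\<dots> = S (max a x)"
      using Q(1) S(1) by (cases "a \<le> x") (auto simp: max_def)
    finally show ?thesis .
  qed
  then show ?thesis using that Q S by blast
qed

section \<open>The Osgood integral\<close>

text \<open>\<open>G\<close> is a primitive of \<open>b\<close>, and \<Phi> is a primitive of the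
  Osgood integrand. Below \<alpha> the integrand is frozen at its value at \<alpha>, which makes
  \<Phi> differentiable and increasing on the whole line.\<close>

locale osgood =
  fixes b G \<Phi> :: "real \<Rightarrow> real" and \<alpha> \<beta> :: real
  assumes b_nonneg: "0 \<le> b x"
    and \<beta>_pos: "0 < \<beta>"
    and DERIV_G: "(G has_real_derivative b x) (at x)"
    and DERIV_\<Phi>: "(\<Phi> has_real_derivative 1 / sqrt (\<beta>\<^sup>2 + 2 * (G (max \<alpha> x) - G \<alpha>))) (at x)"
begin

text \<open>The squared speed at position \<open>x\<close> of the solution of
  \<open>w'' = b(w)\<close> that leaves \<alpha> with speed \<beta>; accordingly \<Phi> measures its
  travel time.\<close>

definition energy :: "real \<Rightarrow> real" where
  "energy x = \<beta>\<^sup>2 + 2 * (G x - G \<alpha>)"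

lemma G_mono: "x \<le> y \<Longrightarrow> G x \<le> G y"
  by (rule DERIV_nonneg_imp_nondecreasing) (use DERIV_G b_nonneg in blast)+

lemma energy_pos: "\<alpha> \<le> x \<Longrightarrow> 0 < energy x"
  using G_mono[of \<alpha> x] \<beta>_pos unfolding energy_def by (auto intro!: add_pos_nonneg)

lemma DERIV_energy: "(energy has_real_derivative 2 * b x) (at x)"
  unfolding energy_def [abs_def] by (auto intro!: derivative_eq_intros DERIV_G)

lemma DERIV_\<Phi>_energy: "\<alpha> \<le> x \<Longrightarrow> (\<Phi> has_real_derivative 1 / sqrt (energy x)) (at x)"
  using DERIV_\<Phi>[of x] by (simp add: energy_def max_absorb2)

lemma \<Phi>_mono: "x \<le> y \<Longrightarrow> \<Phi> x \<le> \<Phi> y"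
proof (rule DERIV_nonneg_imp_nondecreasing[where f = \<Phi>])
  fix z
  have "0 \<le> 1 / sqrt (\<beta>\<^sup>2 + 2 * (G (max \<alpha> z) - G \<alpha>))"
    using energy_pos[of "max \<alpha> z"] by (simp add: energy_def)
  then show "\<exists>d. (\<Phi> has_real_derivative d) (at z) \<and> 0 \<le> d" using DERIV_\<Phi> by blast
qed

text \<open>Since the energy is positive from \<alpha> on, the denominator never vanishes and the
  extended quotient is an ordinary real one.\<close>

lemma osgood_integral_eq:
  "osgood_integral b \<alpha> \<beta> = (\<integral>\<^sup>+s\<in>{\<alpha>..}. ennreal (1 / sqrt (energy (max \<alpha> s))) \<partial>lborel)"
proof -
  have "1 / ennreal (sqrt (\<beta>\<^sup>2 + 2 * integral {\<alpha>..s} b)) = ennreal (1 / sqrt (energy (max \<alpha> s)))" for s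
  proof -
    have "integral {\<alpha>..s} b = G (max \<alpha> s) - G \<alpha>"
      by (rule integral_max_eq) (rule DERIV_G)
    then have *: "\<beta>\<^sup>2 + 2 * integral {\<alpha>..s} b = energy (max \<alpha> s)" by (simp add: energy_def)
    show ?thesis unfolding *
      using energy_pos[of "max \<alpha> s"] divide_ennreal[of 1 "sqrt (energy (max \<alpha> s))"] by simp
  qed
  then show ?thesis by (simp add: osgood_integral_def)
qed

lemma isCont_integrand: "isCont (\<lambda>s. 1 / sqrt (energy (max \<alpha> s))) x"
proof -
  have "continuous_on UNIV energy"
    using DERIV_energy by (meson DERIV_continuous_on UNIV_I has_field_derivative_at_within)
  then have "continuous_on UNIV (\<lambda>s. energy (max \<alpha> s))"
    by (rule continuous_on_compose2) (auto intro!: continuous_intros)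
  moreover have "energy (max \<alpha> s) \<noteq> 0" for s
    using energy_pos[of "max \<alpha> s"] by simp
  ultimately have "continuous_on UNIV (\<lambda>s. 1 / sqrt (energy (max \<alpha> s)))"
    by (intro continuous_intros) auto
  then show ?thesis by (simp add: continuous_on_eq_continuous_at)
qed

lemma measurable_integrand: "(\<lambda>s. 1 / sqrt (energy (max \<alpha> s))) \<in> borel_measurable borel"
  using isCont_integrand
  by (intro borel_measurable_continuous_onI) (simp add: continuous_at_imp_continuous_on)

lemma integrand_nonneg: "0 \<le> 1 / sqrt (energy (max \<alpha> s))"
  using energy_pos[of "max \<alpha> s"] by simp

lemma DERIV_\<Phi>_integrand: "(\<Phi> has_real_derivative 1 / sqrt (energy (max \<alpha> s))) (at s)"
  using DERIV_\<Phi>[of s] by (simp add: energy_def)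

text \<open>\<Phi> is a nondecreasing primitive of the integrand: its increments from \<alpha> are
  partial integrals, and if bounded it converges to its supremum, which gives the improper
  integral.\<close>

lemma osgood_integral_finite_iff:
  "osgood_integral b \<alpha> \<beta> < \<infinity> \<longleftrightarrow> (\<exists>K. \<forall>x. \<Phi> x \<le> K)"
proof
  assume fin: "osgood_integral b \<alpha> \<beta> < \<infinity>"
  have "\<Phi> x \<le> \<Phi> \<alpha> + enn2real (osgood_integral b \<alpha> \<beta>)" for x
  proof (cases "\<alpha> \<le> x")
    case True
    have "ennreal (\<Phi> x - \<Phi> \<alpha>)
        = (\<integral>\<^sup>+s. ennreal (1 / sqrt (energy (max \<alpha> s))) * indicator {\<alpha>..x} s \<partial>lborel)"
      by (rule nn_integral_FTC_Icc[OF measurable_integrand DERIV_\<Phi>_integrand integrand_nonneg True, symmetric])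
    also have "\<dots> \<le> osgood_integral b \<alpha> \<beta>"
      unfolding osgood_integral_eq by (intro nn_integral_mono) (auto simp: indicator_def)
    finally have "\<Phi> x - \<Phi> \<alpha> \<le> enn2real (osgood_integral b \<alpha> \<beta>)"
      using fin enn2real_mono[of "ennreal (\<Phi> x - \<Phi> \<alpha>)" "osgood_integral b \<alpha> \<beta>"]
        \<Phi>_mono[OF True] by (simp add: infinity_ennreal_def)
    then show ?thesis by simp
  next
    case False
    then show ?thesis using \<Phi>_mono[of x \<alpha>] enn2real_nonneg[of "osgood_integral b \<alpha> \<beta>"] by linarith
  qed
  then show "\<exists>K. \<forall>x. \<Phi> x \<le> K" by blast
next
  assume "\<exists>K. \<forall>x. \<Phi> x \<le> K"
  then have bdd: "bdd_above (range \<Phi>)" by (auto simp: bdd_above_def)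
  have "(\<Phi> \<longlongrightarrow> (SUP x. \<Phi> x)) at_top"
  proof (rule increasing_tendsto)
    show "\<forall>\<^sub>F x in at_top. \<Phi> x \<le> (SUP x. \<Phi> x)"
      using bdd by (simp add: cSUP_upper)
    fix l assume "l < (SUP x. \<Phi> x)"
    then obtain y where "l < \<Phi> y" using bdd by (auto simp: less_cSUP_iff)
    then show "\<forall>\<^sub>F x in at_top. l < \<Phi> x"
      using \<Phi>_mono by (auto intro!: eventually_mono[OF eventually_ge_at_top[of y]] dest: order.strict_trans2)
  qed
  from nn_integral_FTC_atLeast[OF measurable_integrand DERIV_\<Phi>_integrand integrand_nonneg this]
  show "osgood_integral b \<alpha> \<beta> < \<infinity>"
    unfolding osgood_integral_eq by simp
qed

text \<open>If \<open>b\<close> stayed below \<open>L\<close>, the energy would grow at most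
  linearly, so \<Phi> would grow at least like a square root.\<close>

lemma \<Phi>_bounded_imp_b_unbounded:
  assumes "\<And>x. \<Phi> x \<le> K"
  shows "\<exists>x. L \<le> b x"
proof (rule ccontr)
  assume "\<nexists>x. L \<le> b x"
  then have bL: "b x \<le> L" for x by (meson linear)
  then have L: "0 \<le> L" using b_nonneg[of 0] by (meson order_trans)
  have grow: "x / sqrt (\<beta>\<^sup>2 + 2 * (L * x)) \<le> \<Phi> (\<alpha> + x) - \<Phi> \<alpha>" if "0 < x" for x
  proof -
    define k where "k = 1 / sqrt (\<beta>\<^sup>2 + 2 * (L * x))"
    \<comment> \<open>On \<open>[\<alpha>, \<alpha> + x]\<close> the slope of \<Phi> is at least
      \<open>k\<close>.\<close>
    have "\<Phi> \<alpha> - k * \<alpha> \<le> \<Phi> (\<alpha> + x) - k * (\<alpha> + x)"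
    proof (rule DERIV_nonneg_imp_nondecreasing[where f = "\<lambda>y. \<Phi> y - k * y"])
      fix y assume y: "\<alpha> \<le> y" "y \<le> \<alpha> + x"
      have "\<bar>G y - G \<alpha>\<bar> \<le> L * \<bar>y - \<alpha>\<bar>"
        using field_differentiable_bound[of UNIV G b L y \<alpha>] DERIV_G bL b_nonneg by simp
      also have "\<dots> \<le> L * x" using y L by (intro mult_left_mono) auto
      finally have "energy y \<le> \<beta>\<^sup>2 + 2 * (L * x)" by (simp add: energy_def)
      then have "k \<le> 1 / sqrt (energy y)"
        unfolding k_def using energy_pos[OF y(1)] by (intro divide_left_mono) auto
      then show "\<exists>d. ((\<lambda>y. \<Phi> y - k * y) has_real_derivative d) (at y) \<and> 0 \<le> d"
        using y(1) by (intro exI[of _ "1 / sqrt (energy y) - k"])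
          (auto intro!: derivative_eq_intros DERIV_\<Phi>_energy)
    qed (use that in simp)
    then have "k * x \<le> \<Phi> (\<alpha> + x) - \<Phi> \<alpha>" by (simp add: distrib_left)
    then show ?thesis by (simp add: k_def)
  qed
  define D where "D = \<bar>K - \<Phi> \<alpha>\<bar> + 1"
  \<comment> \<open>With this choice \<open>D\<^sup>2 * (\<beta>\<^sup>2 + 2 * L) = x - 1\<close>,
    so the lower bound for the increase of \<Phi> reaches \<open>D\<close>, which exceeds
    \<open>K - \<Phi> \<alpha>\<close>.\<close>
  define x where "x = 1 + D\<^sup>2 * (\<beta>\<^sup>2 + 2 * L)"
  have x: "1 \<le> x" using L by (simp add: x_def)
  have pos: "0 < \<beta>\<^sup>2 + 2 * (L * x)" using L x \<beta>_pos by (intro add_pos_nonneg) auto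
  have "\<beta>\<^sup>2 * 1 \<le> \<beta>\<^sup>2 * x" using x by (intro mult_left_mono) auto
  then have "D\<^sup>2 * (\<beta>\<^sup>2 + 2 * (L * x)) \<le> D\<^sup>2 * ((\<beta>\<^sup>2 + 2 * L) * x)"
    by (intro mult_left_mono) (auto simp: algebra_simps)
  also have "\<dots> = (x - 1) * x" by (simp add: x_def)
  also have "\<dots> \<le> x\<^sup>2" using x by (simp add: power2_eq_square algebra_simps)
  finally have "(D * sqrt (\<beta>\<^sup>2 + 2 * (L * x)))\<^sup>2 \<le> x\<^sup>2"
    using pos by (simp add: power_mult_distrib)
  then have "D * sqrt (\<beta>\<^sup>2 + 2 * (L * x)) \<le> x"
    using x by (auto intro: power2_le_imp_le)
  then have "D \<le> x / sqrt (\<beta>\<^sup>2 + 2 * (L * x))" using pos by (simp add: pos_le_divide_eq)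
  with grow[of x] assms[of "\<alpha> + x"] x show False by (auto simp: D_def)
qed

text \<open>Multiplying \<open>w'' \<ge> b(w)\<close> by \<open>w'\<close> shows that \<open>w'\<^sup>2 - energy w\<close> is nondecreasing,
  and then \<open>w' \<ge> sqrt (energy w)\<close> says that \<open>\<Phi>(w)\<close> grows at least with unit speed.\<close>
lemma supersolution_fast:
  assumes "t0 \<le> t1"
    and w: "\<And>t. t0 \<le> t \<Longrightarrow> t \<le> t1 \<Longrightarrow> (w has_real_derivative v t) (at t)"
    and v: "\<And>t. t0 \<le> t \<Longrightarrow> t \<le> t1 \<Longrightarrow> (v has_real_derivative q t) (at t)"
    and q: "\<And>t. t0 \<le> t \<Longrightarrow> t \<le> t1 \<Longrightarrow> b (w t) \<le> q t"
    and nonneg: "\<And>t. t0 \<le> t \<Longrightarrow> t \<le> t1 \<Longrightarrow> 0 \<le> v t"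
    and ge: "\<And>t. t0 \<le> t \<Longrightarrow> t \<le> t1 \<Longrightarrow> \<alpha> \<le> w t"
    and start: "energy (w t0) \<le> (v t0)\<^sup>2"
  shows "t1 - t0 \<le> \<Phi> (w t1) - \<Phi> (w t0)"
proof -
  have en: "energy (w t) \<le> (v t)\<^sup>2" if t: "t0 \<le> t" "t \<le> t1" for t
  proof -
    have "(v t0)\<^sup>2 - energy (w t0) \<le> (v t)\<^sup>2 - energy (w t)"
    proof (rule DERIV_nonneg_imp_nondecreasing[OF t(1)])
      fix s assume s: "t0 \<le> s" "s \<le> t"
      then have "s \<le> t1" using t by simp
      note s = s(1) this
      have "((\<lambda>s. (v s)\<^sup>2 - energy (w s)) has_real_derivative 2 * v s * (q s - b (w s))) (at s)"
        by (auto intro!: derivative_eq_intros v[OF s] w[OF s] DERIV_chain2[OF DERIV_energy]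
            simp: algebra_simps)
      moreover have "0 \<le> 2 * v s * (q s - b (w s))" using nonneg[OF s] q[OF s] by simp
      ultimately show "\<exists>d. ((\<lambda>s. (v s)\<^sup>2 - energy (w s)) has_real_derivative d) (at s) \<and> 0 \<le> d"
        by blast
    qed
    then show ?thesis using start by simp
  qed
  have "\<Phi> (w t0) - t0 \<le> \<Phi> (w t1) - t1"
  proof (rule DERIV_nonneg_imp_nondecreasing[OF assms(1)])
    fix s assume s: "t0 \<le> s" "s \<le> t1"
    have "((\<lambda>s. \<Phi> (w s) - s) has_real_derivative 1 / sqrt (energy (w s)) * v s - 1) (at s)"
      by (auto intro!: derivative_eq_intros w[OF s] DERIV_chain2[OF DERIV_\<Phi>_energy] ge[OF s])
    moreover have "sqrt (energy (w s)) \<le> v s" using en[OF s] nonneg[OF s] by (rule real_le_lsqrt[rotated])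
    then have "0 \<le> 1 / sqrt (energy (w s)) * v s - 1" using energy_pos[OF ge[OF s]] by simp
    ultimately show "\<exists>d. ((\<lambda>s. \<Phi> (w s) - s) has_real_derivative d) (at s) \<and> 0 \<le> d" by blast
  qed
  then show ?thesis by simp
qed

text \<open>The energy argument of \<open>supersolution_fast\<close> with the inequalities reversed:
  the speed stays below the square root of the energy, so \<Phi> along \<open>w\<close> grows at
  most with unit speed.\<close>

lemma subsolution_slow:
  assumes "t0 \<le> t1"
    and w: "\<And>t. t0 \<le> t \<Longrightarrow> t \<le> t1 \<Longrightarrow> (w has_real_derivative v t) (at t)"
    and v: "\<And>t. t0 \<le> t \<Longrightarrow> t \<le> t1 \<Longrightarrow> (v has_real_derivative q t) (at t)"
    and q: "\<And>t. t0 \<le> t \<Longrightarrow> t \<le> t1 \<Longrightarrow> q t \<le> b (w t)"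
    and nonneg: "\<And>t. t0 \<le> t \<Longrightarrow> t \<le> t1 \<Longrightarrow> 0 \<le> v t"
    and ge: "\<And>t. t0 \<le> t \<Longrightarrow> t \<le> t1 \<Longrightarrow> \<alpha> \<le> w t"
    and start: "(v t0)\<^sup>2 \<le> energy (w t0)"
  shows "\<Phi> (w t1) - \<Phi> (w t0) \<le> t1 - t0"
proof -
  have en: "(v t)\<^sup>2 \<le> energy (w t)" if t: "t0 \<le> t" "t \<le> t1" for t
  proof -
    have "energy (w t0) - (v t0)\<^sup>2 \<le> energy (w t) - (v t)\<^sup>2"
    proof (rule DERIV_nonneg_imp_nondecreasing[OF t(1)])
      fix s assume s: "t0 \<le> s" "s \<le> t"
      then have "s \<le> t1" using t by simp
      note s = s(1) this
      have "((\<lambda>s. energy (w s) - (v s)\<^sup>2) has_real_derivative 2 * v s * (b (w s) - q s)) (at s)"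
        by (auto intro!: derivative_eq_intros v[OF s] w[OF s] DERIV_chain2[OF DERIV_energy]
            simp: algebra_simps)
      moreover have "0 \<le> 2 * v s * (b (w s) - q s)" using nonneg[OF s] q[OF s] by simp
      ultimately show "\<exists>d. ((\<lambda>s. energy (w s) - (v s)\<^sup>2) has_real_derivative d) (at s) \<and> 0 \<le> d"
        by blast
    qed
    then show ?thesis using start by simp
  qed
  have "t0 - \<Phi> (w t0) \<le> t1 - \<Phi> (w t1)"
  proof (rule DERIV_nonneg_imp_nondecreasing[OF assms(1)])
    fix s assume s: "t0 \<le> s" "s \<le> t1"
    have "((\<lambda>s. s - \<Phi> (w s)) has_real_derivative 1 - 1 / sqrt (energy (w s)) * v s) (at s)"
      by (auto intro!: derivative_eq_intros w[OF s] DERIV_chain2[OF DERIV_\<Phi>_energy] ge[OF s])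
    moreover have "v s \<le> sqrt (energy (w s))" using en[OF s] by (rule real_le_rsqrt)
    then have "0 \<le> 1 - 1 / sqrt (energy (w s)) * v s" using energy_pos[OF ge[OF s]] by simp
    ultimately show "\<exists>d. ((\<lambda>s. s - \<Phi> (w s)) has_real_derivative d) (at s) \<and> 0 \<le> d" by blast
  qed
  then show ?thesis by simp
qed

end

text \<open>Two successive antiderivatives; the second exists because the radicand is continuous and
  positive.\<close>

lemma osgood_exists:
  assumes b_nonneg: "\<And>x. 0 \<le> b x" and b_cont: "continuous_on UNIV b" and "0 < \<beta>"
  obtains G \<Phi> where "osgood b G \<Phi> \<alpha> \<beta>"
proof -
  have "isCont b x" for x using b_cont by (simp add: continuous_on_eq_continuous_at)
  then obtain G where G: "\<And>x. (G has_real_derivative b x) (at x)"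
    using antiderivative_upto[of \<infinity> b 0] by simp blast
  have contG: "continuous_on UNIV G"
    using G by (meson DERIV_continuous_on UNIV_I has_field_derivative_at_within)
  have "G \<alpha> \<le> G (max \<alpha> x)" for x
    by (rule DERIV_nonneg_imp_nondecreasing) (use G b_nonneg in auto)
  then have "\<beta>\<^sup>2 + 2 * (G (max \<alpha> x) - G \<alpha>) > 0" for x
    using \<open>0 < \<beta>\<close> by (intro add_pos_nonneg) auto
  then have "continuous_on UNIV (\<lambda>x. 1 / sqrt (\<beta>\<^sup>2 + 2 * (G (max \<alpha> x) - G \<alpha>)))"
    by (intro continuous_intros continuous_on_compose2[OF contG]) (auto simp: less_le)
  then have "isCont (\<lambda>x. 1 / sqrt (\<beta>\<^sup>2 + 2 * (G (max \<alpha> x) - G \<alpha>))) x" for x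
    by (simp add: continuous_on_eq_continuous_at)
  then obtain \<Phi> where "\<And>x. (\<Phi> has_real_derivative 1 / sqrt (\<beta>\<^sup>2 + 2 * (G (max \<alpha> x) - G \<alpha>))) (at x)"
    using antiderivative_upto[of \<infinity> "\<lambda>x. 1 / sqrt (\<beta>\<^sup>2 + 2 * (G (max \<alpha> x) - G \<alpha>))" 0] by simp blast
  with G b_nonneg \<open>0 < \<beta>\<close> have "osgood b G \<Phi> \<alpha> \<beta>" by unfold_locales
  then show ?thesis by (rule that)
qed

section \<open>Continuation of bounded solutions\<close>

text \<open>The integral equation in differential form: \<open>S'' = Q' = b(X)\<close> with zero
  initial data. The clamp \<open>max 0 t\<close> continues \<open>X\<close> constantly to negative
  times, where its given values are arbitrary.\<close>

locale solution_primitives =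
  fixes b :: "real \<Rightarrow> real" and A B :: real and g :: "real \<Rightarrow> real" and T :: ereal
    and X Q S :: "real \<Rightarrow> real"
  assumes b_nonneg: "0 \<le> b x"
    and Q_0: "Q 0 = 0" and S_0: "S 0 = 0"
    and DERIV_Q: "ereal t < T \<Longrightarrow> (Q has_real_derivative b (X (max 0 t))) (at t)"
    and DERIV_S: "ereal t < T \<Longrightarrow> (S has_real_derivative Q t) (at t)"
    and X_eq: "0 \<le> t \<Longrightarrow> ereal t < T \<Longrightarrow> X t = A + B * t + S t + g t"
begin

lemma less_T: "s \<le> t \<Longrightarrow> ereal t < T \<Longrightarrow> ereal s < T"
  by (meson ereal_less_eq(3) order_le_less_trans)

lemma Q_nonneg:
  assumes "0 \<le> t" "ereal t < T"
  shows "0 \<le> Q t"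
proof -
  have "Q 0 \<le> Q t"
  proof (rule DERIV_nonneg_imp_nondecreasing[where f = Q])
    fix r assume "r \<le> t"
    then have "ereal r < T" using assms less_T by auto
    then show "\<exists>d. (Q has_real_derivative d) (at r) \<and> 0 \<le> d" using DERIV_Q b_nonneg by blast
  qed (rule assms)
  then show ?thesis by (simp add: Q_0)
qed

lemma S_mono:
  assumes "0 \<le> s" "s \<le> t" "ereal t < T"
  shows "S s \<le> S t"
proof (rule DERIV_nonneg_imp_nondecreasing[where f = S])
  fix r assume "s \<le> r" "r \<le> t"
  then have "0 \<le> r" "ereal r < T" using assms less_T by auto
  then show "\<exists>d. (S has_real_derivative d) (at r) \<and> 0 \<le> d" using DERIV_S Q_nonneg by blast
qed (rule assms)

lemma S_nonneg: "0 \<le> t \<Longrightarrow> ereal t < T \<Longrightarrow> 0 \<le> S t"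
  using S_mono[of 0 t] by (simp add: S_0)

end

lemma solution_primitives_exist:
  assumes b_cont: "continuous_on UNIV b" and b_nonneg: "\<And>x. 0 \<le> b x"
    and "0 < T" and sol: "solves_on b A B g T X"
  obtains Q S where "solution_primitives b A B g T X Q S"
proof -
  have "isCont (\<lambda>t. b (X (max 0 t))) t" if "ereal t < T" for t
  proof -
    \<comment> \<open>On an open set, continuity on the set is continuity at each of its
      points.\<close>
    have "open {t. ereal t < T}" by (intro open_Collect_less continuous_intros)
    moreover have "continuous_on {t. ereal t < T} (\<lambda>t. b (X (max 0 t)))"
    proof (rule continuous_on_compose2[OF b_cont])
      have "continuous_on (time_interval T) X" using sol unfolding solves_on_def by blast
      then show "continuous_on {t. ereal t < T} (\<lambda>t. X (max 0 t))"
        by (rule continuous_on_compose2)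
          (use \<open>0 < T\<close> in \<open>auto simp: time_interval_def zero_ereal_def split: split_max intro!: continuous_intros\<close>)
    qed auto
    ultimately show ?thesis using that by (simp add: continuous_on_eq_continuous_at)
  qed
  then obtain Q S where Q0: "Q 0 = 0" and S0: "S 0 = 0"
    and Q: "\<And>t. ereal t < T \<Longrightarrow> (Q has_real_derivative b (X (max 0 t))) (at t)"
    and S: "\<And>t. ereal t < T \<Longrightarrow> (S has_real_derivative Q t) (at t)"
    and int: "\<And>t. ereal t < T \<Longrightarrow> integral {0..t} (\<lambda>s. (t - s) * b (X (max 0 s))) = S (max 0 t)"
    using volterra_integral[of T "\<lambda>t. b (X (max 0 t))" 0] \<open>0 < T\<close> by (auto simp: zero_ereal_def)
  have "X t = A + B * t + S t + g t" if t: "0 \<le> t" "ereal t < T" for t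
  proof -
    have "integral {0..t} (\<lambda>s. (t - s) * b (X s)) = integral {0..t} (\<lambda>s. (t - s) * b (X (max 0 s)))"
      by (intro integral_cong) auto
    also have "\<dots> = S t" using int[OF t(2)] t by simp
    finally show ?thesis using sol t by (simp add: solves_on_def time_interval_def)
  qed
  then have "solution_primitives b A B g T X Q S" using b_nonneg Q0 S0 Q S by unfold_locales
  then show ?thesis by (rule that)
qed

text \<open>Boundedness of \<open>X\<close> bounds \<open>b(X)\<close>, hence \<open>Q\<close>, so
  \<open>S\<close> is Lipschitz and extends continuously to the end point \<tau>; the equation then
  passes to the limit.\<close>

lemma bounded_solution_closes:
  fixes X :: "real \<Rightarrow> real"
  assumes b_cont: "continuous_on UNIV b" and b_nonneg: "\<And>x. 0 \<le> b x"
    and "0 < \<tau>" and g: "continuous_on {0..} g"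
    and sol: "solves_on b A B g (ereal \<tau>) X" and bdd: "bounded (X ` {0..<\<tau>})"
  obtains Y where "continuous_on {0..\<tau>} Y" "\<And>t. t \<in> {0..<\<tau>} \<Longrightarrow> Y t = X t"
    and "\<And>t. t \<in> {0..\<tau>} \<Longrightarrow> Y t = A + B * t + integral {0..t} (\<lambda>s. (t - s) * b (Y s)) + g t"
proof -
  have "0 < ereal \<tau>" using \<open>0 < \<tau>\<close> by simp
  then obtain Q S where "solution_primitives b A B g (ereal \<tau>) X Q S"
    using solution_primitives_exist[OF b_cont b_nonneg _ sol] by blast
  then interpret P: solution_primitives b A B g "ereal \<tau>" X Q S .
  \<comment> \<open>The values of \<open>X\<close> may accumulate outside its range, so
    \<open>b\<close> is bounded on the compact closure.\<close>
  have "compact (b ` closure (X ` {0..<\<tau>}))"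
    using bdd b_cont by (intro compact_continuous_image) (auto intro: continuous_on_subset)
  then have "bounded (b ` closure (X ` {0..<\<tau>}))" by (rule compact_imp_bounded)
  then obtain K where K: "\<And>x. x \<in> closure (X ` {0..<\<tau>}) \<Longrightarrow> norm (b x) \<le> K"
    unfolding bounded_iff by auto
  have bK: "norm (b (X (max 0 t))) \<le> K" if "t \<in> {0..<\<tau>}" for t
    using that by (intro K subsetD[OF closure_subset]) auto
  then have "0 \<le> K" using \<open>0 < \<tau>\<close> order_trans[OF norm_ge_zero bK[of 0]] by simp
  have "norm (Q t) \<le> K * \<tau>" if "t \<in> {0..<\<tau>}" for t
  proof -
    have "norm (Q t - Q 0) \<le> K * norm (t - 0)"
      using that P.DERIV_Q bK by (intro field_differentiable_bound[where S = "{0..<\<tau>}"])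
        (auto intro: has_field_derivative_at_within)
    also have "\<dots> \<le> K * \<tau>" using that \<open>0 \<le> K\<close> by (intro mult_left_mono) auto
    finally show ?thesis by (simp add: P.Q_0)
  qed
  then have "norm (S s - S t) \<le> K * \<tau> * norm (s - t)" if "s \<in> {0..<\<tau>}" "t \<in> {0..<\<tau>}" for s t
    using that P.DERIV_S by (intro field_differentiable_bound[where S = "{0..<\<tau>}"])
      (auto intro: has_field_derivative_at_within)
  then have "(K * \<tau>)-lipschitz_on {0..<\<tau>} S"
    using \<open>0 \<le> K\<close> \<open>0 < \<tau>\<close> by (intro lipschitz_onI) (auto simp: dist_norm)
  then have "uniformly_continuous_on {0..<\<tau>} S" by (rule lipschitz_on_uniformly_continuous)
  then obtain R where R: "uniformly_continuous_on (closure {0..<\<tau>}) R" "\<And>t. t \<in> {0..<\<tau>} \<Longrightarrow> S t = R t"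
  proof (rule uniformly_continuous_on_extension_on_closure)
    fix R assume "uniformly_continuous_on (closure {0..<\<tau>}) R" "\<And>t. t \<in> {0..<\<tau>} \<Longrightarrow> S t = R t"
    then show thesis by (rule that)
  qed
  have clos: "closure {0..<\<tau>} = {0..\<tau>}" using \<open>0 < \<tau>\<close> by simp
  have contR: "continuous_on {0..\<tau>} R"
    using uniformly_continuous_imp_continuous[OF R(1)] clos by simp
  \<comment> \<open>\<open>R\<close> is the extension of \<open>S\<close> to
    \<open>[0, \<tau>]\<close>; replacing \<open>S\<close> by it in the equation for
    \<open>X\<close> gives the candidate.\<close>
  define Y where "Y t = A + B * t + R t + g t" for t
  have contY: "continuous_on {0..\<tau>} Y"
    unfolding Y_def by (intro continuous_intros contR continuous_on_subset[OF g]) auto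
  have YX: "Y t = X t" if "t \<in> {0..<\<tau>}" for t
    using that P.X_eq R(2) by (simp add: Y_def)
  have "continuous_on UNIV (\<lambda>t. b (Y (max 0 (min \<tau> t))))"
    using \<open>0 < \<tau>\<close> by (intro continuous_on_compose2[OF b_cont] continuous_on_compose2[OF contY] continuous_intros) auto
  then have cont: "isCont (\<lambda>t. b (Y (max 0 (min \<tau> t)))) t" for t
    by (simp add: continuous_on_eq_continuous_at)
  obtain P where P: "\<And>t. isCont P t"
    and intP: "\<And>t. integral {0..t} (\<lambda>s. (t - s) * b (Y (max 0 (min \<tau> s)))) = P (max 0 t)"
  proof (rule volterra_integral[of \<infinity> "\<lambda>t. b (Y (max 0 (min \<tau> t)))" 0, OF cont])
    show "ereal 0 < \<infinity>" by simp
    fix Q S :: "real \<Rightarrow> real"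
    assume S: "\<And>t. ereal t < \<infinity> \<Longrightarrow> (S has_real_derivative Q t) (at t)"
      and int: "\<And>t. ereal t < \<infinity> \<Longrightarrow> integral {0..t} (\<lambda>s. (t - s) * b (Y (max 0 (min \<tau> s)))) = S (max 0 t)"
    have "isCont S t" for t by (rule DERIV_isCont[OF S]) simp
    with int show thesis using that[of S] by simp
  qed
  have intY: "integral {0..t} (\<lambda>s. (t - s) * b (Y s)) = P t" if "t \<in> {0..\<tau>}" for t
  proof -
    have "integral {0..t} (\<lambda>s. (t - s) * b (Y s)) = integral {0..t} (\<lambda>s. (t - s) * b (Y (max 0 (min \<tau> s))))"
      using that by (intro integral_cong) (auto simp: min_def)
    then show ?thesis using intP[of t] that by simp
  qed
  \<comment> \<open>The double primitive \<open>P\<close> built from \<open>Y\<close> agrees with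
    \<open>R\<close> before \<tau>, where \<open>Y\<close> is \<open>X\<close>, and at \<tau> by
    continuity.\<close>
  have "P t - R t = 0" if "t \<in> {0..\<tau>}" for t
  proof (rule continuous_constant_on_closure[where S = "{0..<\<tau>}" and f = "\<lambda>t. P t - R t"])
    show "continuous_on (closure {0..<\<tau>}) (\<lambda>t. P t - R t)"
      unfolding clos using P by (intro continuous_intros contR) (simp add: continuous_at_imp_continuous_on)
    fix t assume t: "t \<in> {0..<\<tau>}"
    have "P t = integral {0..t} (\<lambda>s. (t - s) * b (X s))"
      using t YX by (subst intY[symmetric]) (auto intro!: integral_cong)
    also have "\<dots> = X t - A - B * t - g t"
      using sol t by (simp add: solves_on_def time_interval_def)
    finally show "P t - R t = 0" using YX[OF t] by (simp add: Y_def)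
  qed (use that clos in auto)
  then have "Y t = A + B * t + integral {0..t} (\<lambda>s. (t - s) * b (Y s)) + g t" if "t \<in> {0..\<tau>}" for t
    using intY[OF that] that by (simp add: Y_def)
  then show ?thesis using that contY YX by blast
qed

text \<open>The nonlinearity is frozen outside a neighbourhood of \<open>X \<tau>\<close> where \<open>b\<close> is Lipschitz, and the
  contraction acts on functions on the whole line: time is clamped to \<open>[0, \<tau> + \<delta>]\<close>, and since the
  integral over \<open>{\<tau>..t}\<close> vanishes for \<open>t \<le> \<tau>\<close>, the fixed point agrees with \<open>X\<close> on \<open>[0, \<tau>]\<close>.\<close>
lemma closed_solution_extends:
  fixes X :: "real \<Rightarrow> real"
  assumes lip: "local_lipschitz (UNIV :: real set) UNIV (\<lambda>_. b)"
    and "0 \<le> \<tau>" and g: "continuous_on {0..} g" and contX: "continuous_on {0..\<tau>} X"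
    and X: "\<And>t. t \<in> {0..\<tau>} \<Longrightarrow> X t = A + B * t + integral {0..t} (\<lambda>s. (t - s) * b (X s)) + g t"
  obtains \<tau>' Y where "\<tau> < \<tau>'" "solves_on b A B g (ereal \<tau>') Y" "\<And>t. t \<in> {0..\<tau>} \<Longrightarrow> Y t = X t"
proof -
  have b_cont: "continuous_on UNIV b"
    using local_lipschitz_continuous_on[OF lip, of 0] by simp
  \<comment> \<open>The time argument of \<open>local_lipschitz\<close> is a dummy, instantiated
    with 0.\<close>
  obtain u L where "0 < u" and "\<forall>t\<in>cball (0::real) u \<inter> UNIV. L-lipschitz_on (cball (X \<tau>) u \<inter> UNIV) b"
    using bspec[OF bspec[OF lip[unfolded local_lipschitz_def] UNIV_I] UNIV_I, of 0 "X \<tau>"] by blast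
  then have L: "L-lipschitz_on (cball (X \<tau>) u) b" by (metis Int_UNIV_right centre_in_cball less_imp_le)
  have "0 \<le> L" using L by (rule lipschitz_on_nonneg)
  define b' where "b' x = b (max (X \<tau> - u) (min (X \<tau> + u) x))" for x
  have b'_eq: "b' x = b x" if "dist (X \<tau>) x \<le> u" for x
  proof -
    have "max (X \<tau> - u) (min (X \<tau> + u) x) = x" using that unfolding dist_real_def by linarith
    then show ?thesis by (simp add: b'_def)
  qed
  have b'_lip: "\<bar>b' x - b' y\<bar> \<le> L * \<bar>x - y\<bar>" for x y
  proof -
    let ?c = "\<lambda>x. max (X \<tau> - u) (min (X \<tau> + u) x)"
    have "\<bar>b' x - b' y\<bar> \<le> L * \<bar>?c x - ?c y\<bar>"
      using lipschitz_onD[OF L, of "?c x" "?c y"] \<open>0 < u\<close>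
      by (auto simp: b'_def dist_real_def max_def min_def)
    also have "\<dots> \<le> L * \<bar>x - y\<bar>"
      using \<open>0 \<le> L\<close> \<open>0 < u\<close> by (intro mult_left_mono) (auto simp: max_def min_def)
    finally show ?thesis .
  qed
  have b'_cont: "continuous_on UNIV b'"
    unfolding b'_def by (intro continuous_on_compose2[OF b_cont] continuous_intros) auto

  \<comment> \<open>The known right-hand side \<open>b(X)\<close>, held constant after
    \<tau>.\<close>
  define c where "c s = b (X (max 0 (min \<tau> s)))" for s
  have c_eq: "c s = b (X s)" if "s \<in> {0..\<tau>}" for s
    using that by (simp add: c_def)
  have c_cont: "continuous_on UNIV c"
    unfolding c_def using \<open>0 \<le> \<tau>\<close>
    by (intro continuous_on_compose2[OF b_cont] continuous_on_compose2[OF contX] continuous_intros) auto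
  have prim: "\<exists>S. continuous_on UNIV S \<and> (\<forall>t. integral {a..t} (\<lambda>s. (t - s) * f s) = S (max a t))"
    if "continuous_on UNIV f" for f :: "real \<Rightarrow> real" and a
  proof -
    have "isCont f t" for t using that by (simp add: continuous_on_eq_continuous_at)
    then obtain Q S where "\<And>t. (S has_real_derivative Q t) (at t)"
      "\<And>t. integral {a..t} (\<lambda>s. (t - s) * f s) = S (max a t)"
    proof (rule volterra_integral[of \<infinity> f a])
      show "ereal a < \<infinity>" by simp
      fix Q S :: "real \<Rightarrow> real"
      assume "\<And>t. ereal t < \<infinity> \<Longrightarrow> (S has_real_derivative Q t) (at t)"
        "\<And>t. ereal t < \<infinity> \<Longrightarrow> integral {a..t} (\<lambda>s. (t - s) * f s) = S (max a t)"
      then show thesis using that[of S Q] by simp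
    qed
    then show ?thesis
      by (intro exI[of _ S]) (auto intro!: DERIV_isCont continuous_at_imp_continuous_on)
  qed
  obtain S where contS: "continuous_on UNIV S"
    and S: "\<And>t. integral {0..t} (\<lambda>s. (t - s) * c s) = S (max 0 t)"
    using prim[OF c_cont] by blast
  define h where "h t = A + B * t + g t + S t" for t
  have h_eq: "h t = X t" if "t \<in> {0..\<tau>}" for t
  proof -
    have "integral {0..t} (\<lambda>s. (t - s) * b (X s)) = integral {0..t} (\<lambda>s. (t - s) * c s)"
      using that c_eq by (intro integral_cong) auto
    then show ?thesis using X[OF that] S[of t] that by (simp add: h_def)
  qed

  \<comment> \<open>On \<open>[\<tau>, \<tau> + \<delta>]\<close> the kernel is at most \<delta> and
    the length at most 1, so the contraction factor is at most
    \<open>\<delta> * L \<le> 1 / 2\<close>.\<close>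
  define \<delta> where "\<delta> = 1 / (2 * (L + 1))"
  have \<delta>: "0 < \<delta>" "\<delta> \<le> 1" "\<delta> * L \<le> 1 / 2"
    using \<open>0 \<le> L\<close> by (auto simp: \<delta>_def field_simps)
  define \<kappa> where "\<kappa> t = max 0 (min (\<tau> + \<delta>) t)" for t
  \<comment> \<open>\<open>h\<close> is what the equation yields with \<open>c\<close> in place of
    \<open>b(Y)\<close>; the integral corrects this after \<tau>.\<close>
  define F where "F Y t = h t + integral {\<tau>..t} (\<lambda>s. (t - s) * (b' (Y s) - c s))" for Y t
  have F_bcont: "(\<lambda>t. F (apply_bcontfun Y) (\<kappa> t)) \<in> bcontfun" for Y
  proof -
    have "continuous_on UNIV (\<lambda>s. b' (apply_bcontfun Y s) - c s)"
      by (intro continuous_intros c_cont continuous_on_compose2[OF b'_cont]) auto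
    from prim[OF this, of \<tau>] obtain P where P: "continuous_on UNIV P"
      "\<And>t. integral {\<tau>..t} (\<lambda>s. (t - s) * (b' (apply_bcontfun Y s) - c s)) = P (max \<tau> t)"
      by blast
    have cont: "continuous_on {0..\<tau> + \<delta>} (F (apply_bcontfun Y))"
      unfolding F_def P(2) h_def
      by (intro continuous_intros continuous_on_subset[OF g] continuous_on_compose2[OF P(1)]
          continuous_on_subset[OF contS]) auto
    then have "bounded (F (apply_bcontfun Y) ` {0..\<tau> + \<delta>})"
      by (intro compact_imp_bounded compact_continuous_image) auto
    moreover have \<kappa>: "\<kappa> t \<in> {0..\<tau> + \<delta>}" for t
      using \<open>0 \<le> \<tau>\<close> \<delta> by (auto simp: \<kappa>_def)
    moreover have "continuous_on UNIV \<kappa>" unfolding \<kappa>_def by (intro continuous_intros)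
    ultimately show ?thesis
      using continuous_on_compose2[OF cont, of UNIV \<kappa>]
      by (auto simp: bcontfun_def image_subset_iff intro: bounded_subset)
  qed
  define \<Psi> where "\<Psi> Y = Bcontfun (\<lambda>t. F (apply_bcontfun Y) (\<kappa> t))" for Y
  have \<Psi>: "apply_bcontfun (\<Psi> Y) t = F (apply_bcontfun Y) (\<kappa> t)" for Y t
    unfolding \<Psi>_def by (simp add: Bcontfun_inverse[OF F_bcont])
  have contr: "dist (\<Psi> Y) (\<Psi> Z) \<le> 1 / 2 * dist Y Z" for Y Z
  proof (rule dist_bound)
    fix t
    let ?k = "\<kappa> t"
    let ?f = "\<lambda>Y s. (?k - s) * (b' (apply_bcontfun Y s) - c s)"
    have k: "?k \<le> \<tau> + \<delta>" using \<open>0 \<le> \<tau>\<close> \<delta> by (auto simp: \<kappa>_def)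
    show "dist (apply_bcontfun (\<Psi> Y) t) (apply_bcontfun (\<Psi> Z) t) \<le> 1 / 2 * dist Y Z"
    proof (cases "\<tau> \<le> ?k")
      case True
      have cont: "continuous_on {\<tau>..?k} (?f Y)" for Y
        by (intro continuous_intros continuous_on_subset[OF c_cont] continuous_on_compose2[OF b'_cont]) auto
      have "dist (apply_bcontfun (\<Psi> Y) t) (apply_bcontfun (\<Psi> Z) t)
          = norm (integral {\<tau>..?k} (\<lambda>s. ?f Y s - ?f Z s))"
        by (subst Henstock_Kurzweil_Integration.integral_diff)
          (auto intro!: integrable_continuous_interval cont simp: \<Psi> F_def dist_real_def)
      also have "\<dots> \<le> (\<delta> * (L * dist Y Z)) * (?k - \<tau>)"
      proof (rule integral_bound[OF True])
        fix s assume s: "s \<in> {\<tau>..?k}"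
        have "\<bar>?k - s\<bar> * \<bar>b' (apply_bcontfun Y s) - b' (apply_bcontfun Z s)\<bar>
            \<le> \<delta> * (L * \<bar>apply_bcontfun Y s - apply_bcontfun Z s\<bar>)"
          using s k by (intro mult_mono b'_lip) (use \<delta> in auto)
        also have "\<dots> \<le> \<delta> * (L * dist Y Z)"
          using dist_bounded[of Y s Z] \<delta> \<open>0 \<le> L\<close>
          by (intro mult_left_mono) (auto simp: dist_real_def)
        finally show "norm (?f Y s - ?f Z s) \<le> \<delta> * (L * dist Y Z)"
          by (simp add: abs_mult flip: right_diff_distrib)
      qed (intro continuous_intros cont)
      also have "\<dots> \<le> (\<delta> * (L * dist Y Z)) * 1"
        using k \<delta> \<open>0 \<le> L\<close> by (intro mult_left_mono) auto
      also have "\<dots> \<le> 1 / 2 * dist Y Z"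
        using mult_right_mono[OF \<delta>(3), of "dist Y Z"] by simp
      finally show ?thesis .
    qed (simp add: \<Psi> F_def)
  qed
  then obtain Y where fixpoint: "\<Psi> Y = Y"
    using banach_fix_type[of "1 / 2" \<Psi>] by auto
  have YF: "apply_bcontfun Y t = F (apply_bcontfun Y) t" if "0 \<le> t" "t \<le> \<tau> + \<delta>" for t
    using that \<Psi>[of Y t] by (simp add: fixpoint \<kappa>_def)
  have YX: "apply_bcontfun Y t = X t" if "t \<in> {0..\<tau>}" for t
  proof -
    have "integral {\<tau>..t} (\<lambda>s. (t - s) * (b' (apply_bcontfun Y s) - c s)) = 0"
      using that by (cases "t = \<tau>") auto
    then show ?thesis using YF[of t] that \<delta> h_eq by (simp add: F_def)
  qed

  have "isCont (apply_bcontfun Y) \<tau>"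
    using continuous_on_apply_bcontfun[of UNIV Y] by (simp add: continuous_on_eq_continuous_at del: continuous_on_apply_bcontfun)
  then obtain d where "0 < d" and d: "\<And>t. dist t \<tau> < d \<Longrightarrow> dist (apply_bcontfun Y t) (X \<tau>) < u"
    using \<open>0 < u\<close> YX[of \<tau>] \<open>0 \<le> \<tau>\<close> unfolding continuous_at_eps_delta by (metis atLeastAtMost_iff order.refl)
  \<comment> \<open>Up to \<open>\<tau> + \<delta>\<close> the fixed point equation is free of the
    clamp; within \<open>d\<close> of \<tau> the fixed point stays where \<open>b'\<close> and
    \<open>b\<close> coincide.\<close>
  define \<tau>' where "\<tau>' = \<tau> + min \<delta> d"
  have "\<tau> < \<tau>'" using \<delta> \<open>0 < d\<close> by (simp add: \<tau>'_def)
  moreover have "solves_on b A B g (ereal \<tau>') (apply_bcontfun Y)"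
    unfolding solves_on_def
  proof (intro conjI ballI)
    fix t assume "t \<in> time_interval (ereal \<tau>')"
    then have t: "0 \<le> t" "t < \<tau> + \<delta>" "t < \<tau> + d" by (auto simp: time_interval_def \<tau>'_def)
    let ?e = "\<lambda>s. (t - s) * (b (apply_bcontfun Y s) - c s)"
    have e_cont: "continuous_on I ?e" for I
      by (intro continuous_intros continuous_on_subset[OF c_cont] continuous_on_compose2[OF b_cont]) auto
    \<comment> \<open>Splitting off \<open>c\<close> leaves the remainder \<open>?e\<close>, which
      vanishes up to \<tau> because \<open>Y = X\<close> there; only the integral from \<tau> in the
      definition of \<open>F\<close> survives.\<close>
    have "integral {0..t} (\<lambda>s. (t - s) * b (apply_bcontfun Y s))
        = integral {0..t} (\<lambda>s. (t - s) * c s + ?e s)"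
      by (simp add: algebra_simps)
    also have "\<dots> = integral {0..t} (\<lambda>s. (t - s) * c s) + integral {0..t} ?e"
      by (intro Henstock_Kurzweil_Integration.integral_add integrable_continuous_interval e_cont
          continuous_intros continuous_on_subset[OF c_cont]) auto
    also have "integral {0..t} (\<lambda>s. (t - s) * c s) = S t" using S[of t] t by simp
    also have "integral {0..t} ?e = integral {\<tau>..t} ?e"
    proof -
      have zero: "integral {0..r} ?e = 0" if "r \<le> \<tau>" for r
        using that YX c_eq integral_cong[of "{0..r}" ?e "\<lambda>_. 0"] by simp
      show ?thesis
      proof (cases "t \<le> \<tau>")
        case True
        then have "integral {\<tau>..t} ?e = 0" by (cases "t = \<tau>") auto
        then show ?thesis using zero[OF True] by simp
      next
        case False
        then show ?thesis
          using Henstock_Kurzweil_Integration.integral_combine[of 0 \<tau> t ?e] zero[of \<tau>] \<open>0 \<le> \<tau>\<close>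
            integrable_continuous_interval[OF e_cont] by simp
      qed
    qed
    also have "\<dots> = integral {\<tau>..t} (\<lambda>s. (t - s) * (b' (apply_bcontfun Y s) - c s))"
    proof (rule integral_cong)
      fix s assume "s \<in> {\<tau>..t}"
      then have "dist (apply_bcontfun Y s) (X \<tau>) < u" using t by (intro d) (auto simp: dist_real_def)
      then show "?e s = (t - s) * (b' (apply_bcontfun Y s) - c s)"
        by (simp add: b'_eq dist_commute)
    qed
    finally show "apply_bcontfun Y t
        = A + B * t + integral {0..t} (\<lambda>s. (t - s) * b (apply_bcontfun Y s)) + g t"
      using YF[of t] t by (simp add: F_def h_def)
  qed simp
  ultimately show ?thesis using that YX by blast
qed

section \<open>The blow-up criterion\<close>

lemma (in osgood) no_global_solution:
  assumes b_cont: "continuous_on UNIV b" and "mono b" and "0 \<le> A" "0 \<le> B"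
    and lim: "Limsup at_top (\<lambda>t::real. INF h\<in>{0..1}. ereal (g (t + h))) = \<infinity>"
    and sol: "solves_on b A B g \<infinity> X"
    and fin: "osgood_integral b \<alpha> \<beta> < \<infinity>"
  shows False
proof -
  obtain Q S where "solution_primitives b A B g \<infinity> X Q S"
    using solution_primitives_exist[OF b_cont b_nonneg _ sol] by auto
  then interpret P: solution_primitives b A B g \<infinity> X Q S .
  obtain K where K: "\<And>x. \<Phi> x \<le> K" using fin osgood_integral_finite_iff by blast
  then have bdd: "bdd_above (range \<Phi>)" by (auto simp: bdd_above_def)
  \<comment> \<open>The travel time left beyond \<open>R\<close> becomes less than 1/4, below the
    half unit of time available at the end.\<close>
  have "(SUP x. \<Phi> x) - 1 / 4 < (SUP x. \<Phi> x)" by simp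
  then obtain y where y: "(SUP x. \<Phi> x) - 1 / 4 < \<Phi> y" using bdd by (auto simp: less_cSUP_iff)
  define R where "R = max \<alpha> y"
  have tail: "\<Phi> x - \<Phi> R < 1 / 4" for x
    using y cSUP_upper[OF _ bdd, of x] \<Phi>_mono[of y R] by (simp add: R_def)
  \<comment> \<open>The factor 2 compensates for the half unit of time in which \<open>Q\<close>
    gains \<open>b M / 2\<close>.\<close>
  obtain z where z: "2 * sqrt (energy R) \<le> b z" using \<Phi>_bounded_imp_b_unbounded[OF K] by blast
  define M where "M = max R z"
  have bM: "2 * sqrt (energy R) \<le> b M"
    using z monoD[OF \<open>mono b\<close>, of z M] by (simp add: M_def)
  define I where "I t = (INF h\<in>{0..1}. ereal (g (t + h)))" for t
  have "\<not> Limsup at_top I \<le> ereal M" using lim by (simp add: I_def [abs_def])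
  \<comment> \<open>The infimum over a unit window exceeds \<open>M\<close> at arbitrarily late
    times, in particular at some \<open>t0 \<ge> 0\<close>.\<close>
  then have "\<not> (\<forall>\<^sub>F t in at_top. I t \<le> ereal M)" using Limsup_bounded by blast
  then obtain t0 where t0: "0 \<le> t0" "ereal M < I t0"
    unfolding eventually_at_top_linorder by (meson not_le)
  have gM: "M \<le> g t" if "t0 \<le> t" "t \<le> t0 + 1" for t
  proof -
    have "I t0 \<le> ereal (g (t0 + (t - t0)))"
      unfolding I_def using that by (intro INF_lower) auto
    with t0(2) have "ereal M < ereal (g (t0 + (t - t0)))" by (rule less_le_trans)
    then show ?thesis by simp
  qed
  have XM: "M + S t \<le> X t" if "t0 \<le> t" "t \<le> t0 + 1" for t
    using P.X_eq[of t] gM[OF that] that t0(1) \<open>0 \<le> A\<close> mult_nonneg_nonneg[OF \<open>0 \<le> B\<close>, of t] by simp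
  define t1 where "t1 = t0 + 1 / 2"
  have "Q t0 - b M * t0 \<le> Q t1 - b M * t1"
  proof (rule DERIV_nonneg_imp_nondecreasing[where f = "\<lambda>t. Q t - b M * t"])
    fix t assume t: "t0 \<le> t" "t \<le> t1"
    have "M \<le> X t" using XM[of t] P.S_nonneg[of t] t t0(1) by (simp add: t1_def)
    then have "b M \<le> b (X (max 0 t))" using monoD[OF \<open>mono b\<close>] t t0(1) by simp
    then show "\<exists>d. ((\<lambda>t. Q t - b M * t) has_real_derivative d) (at t) \<and> 0 \<le> d"
      by (intro exI[of _ "b (X (max 0 t)) - b M"]) (auto intro!: derivative_eq_intros P.DERIV_Q)
  qed (simp add: t1_def)
  then have "b M / 2 \<le> Q t1" using P.Q_nonneg[of t0] t0(1) by (simp add: t1_def algebra_simps)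
  then have "sqrt (energy R) \<le> Q t1" using bM by simp
  then have start: "energy R \<le> (Q t1)\<^sup>2" by (rule sqrt_le_D)
  have "t0 + 1 - t1 \<le> \<Phi> (R + S (t0 + 1) - S t1) - \<Phi> (R + S t1 - S t1)"
  proof (rule supersolution_fast[where v = Q and q = "\<lambda>t. b (X (max 0 t))"])
    fix t assume t: "t1 \<le> t" "t \<le> t0 + 1"
    then have nonneg: "0 \<le> t" "0 \<le> t1" using t0(1) by (auto simp: t1_def)
    show "((\<lambda>t. R + S t - S t1) has_real_derivative Q t) (at t)"
      by (auto intro!: derivative_eq_intros P.DERIV_S)
    show "(Q has_real_derivative b (X (max 0 t))) (at t)" by (intro P.DERIV_Q) simp
    show "0 \<le> Q t" using nonneg by (simp add: P.Q_nonneg)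
    show "\<alpha> \<le> R + S t - S t1" using P.S_mono[OF nonneg(2) t(1)] by (simp add: R_def)
    \<comment> \<open>The comparison function lies below \<open>M + S t\<close>, since
      \<open>R \<le> M\<close> and \<open>S t1 \<ge> 0\<close>.\<close>
    have "R + S t - S t1 \<le> X t"
      using XM[of t] t P.S_nonneg[of t1] nonneg(2) by (simp add: t1_def M_def)
    then show "b (R + S t - S t1) \<le> b (X (max 0 t))"
      using monoD[OF \<open>mono b\<close>] nonneg by simp
  qed (use start in \<open>auto simp: t1_def\<close>)
  then show False using tail[of "R + S (t0 + 1) - S t1"] by (simp add: t1_def)
qed

lemma finite_time_solution_bounded:
  fixes X :: "real \<Rightarrow> real"
  assumes b_nonneg: "\<And>x. 0 \<le> b x" and b_cont: "continuous_on UNIV b" and "mono b"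
    and "0 \<le> A" "0 \<le> B" "0 < \<tau>" and g: "continuous_on {0..} g"
    and sol: "solves_on b A B g (ereal \<tau>) X"
    and inf: "\<And>\<alpha>. 0 < \<alpha> \<Longrightarrow> \<not> osgood_integral b \<alpha> 1 < \<infinity>"
  shows "bounded (X ` {0..<\<tau>})"
proof -
  have "0 < ereal \<tau>" using \<open>0 < \<tau>\<close> by simp
  then obtain Q S where "solution_primitives b A B g (ereal \<tau>) X Q S"
    using solution_primitives_exist[OF b_cont b_nonneg _ sol] by blast
  then interpret P: solution_primitives b A B g "ereal \<tau>" X Q S .
  have "compact (g ` {0..\<tau>})"
    by (intro compact_continuous_image continuous_on_subset[OF g]) auto
  then have "bounded (g ` {0..\<tau>})" by (rule compact_imp_bounded)
  then obtain N where "\<forall>t\<in>{0..\<tau>}. \<bar>g t\<bar> \<le> N"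
    unfolding bounded_iff by auto
  then have N: "\<bar>g t\<bar> \<le> N" if "t \<in> {0..\<tau>}" for t using that by blast
  \<comment> \<open>\<open>C\<close> dominates \<open>A + B * t + g t\<close> up to \<tau> and also
    serves as lower limit of the Osgood integral, which is why it is made positive.\<close>
  define C where "C = max 1 (A + B * \<tau> + N)"
  have XC: "X t \<le> C + S t" if "0 \<le> t" "t < \<tau>" for t
    using P.X_eq[of t] N[of t] that mult_left_mono[OF _ \<open>0 \<le> B\<close>, of t \<tau>] by (simp add: C_def)
  obtain G \<Phi> where "osgood b G \<Phi> C 1" using osgood_exists[OF b_nonneg b_cont, of 1 C] by auto
  then interpret osgood b G \<Phi> C 1 .
  have "\<not> osgood_integral b C 1 < \<infinity>" by (rule inf) (simp add: C_def)
  \<comment> \<open>A barrier: travelling from \<open>C\<close> to \<open>x\<close> takes longer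
    than \<tau>. The function \<open>C + S\<close> starts at rest at \<open>C\<close>, where the
    energy is 1.\<close>
  then obtain x where x: "\<Phi> C + \<tau> < \<Phi> x"
    using osgood_integral_finite_iff by (meson not_le)
  have "norm (X t) \<le> \<bar>x\<bar> + N" if t: "0 \<le> t" "t < \<tau>" for t
  proof -
    have "\<Phi> (C + S t) - \<Phi> (C + S 0) \<le> t - 0"
    proof (rule subsolution_slow[where v = Q and q = "\<lambda>t. b (X (max 0 t))"])
      fix s assume s: "0 \<le> s" "s \<le> t"
      then have "s < \<tau>" using t by simp
      show "((\<lambda>t. C + S t) has_real_derivative Q s) (at s)"
        using \<open>s < \<tau>\<close> by (auto intro!: derivative_eq_intros P.DERIV_S)
      show "(Q has_real_derivative b (X (max 0 s))) (at s)" using \<open>s < \<tau>\<close> by (intro P.DERIV_Q) simp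
      show "0 \<le> Q s" using s \<open>s < \<tau>\<close> by (intro P.Q_nonneg) auto
      show "C \<le> C + S s" using P.S_mono[of 0 s] s \<open>s < \<tau>\<close> P.S_0 by simp
      show "b (X (max 0 s)) \<le> b (C + S s)" using monoD[OF \<open>mono b\<close> XC[of s]] s \<open>s < \<tau>\<close> by simp
    qed (use t energy_pos[of C] in \<open>auto simp: P.Q_0 P.S_0\<close>)
    then have "\<Phi> (C + S t) < \<Phi> x" using x t by (simp add: P.S_0)
    then have "C + S t < x" using \<Phi>_mono[of x "C + S t"] by (meson not_le)
    then have "X t \<le> x" using XC[OF t] by simp
    \<comment> \<open>All terms of the equation other than \<open>g\<close> are nonnegative.\<close>
    moreover have "- N \<le> X t"
      using P.X_eq[of t] N[of t] t P.S_mono[of 0 t] P.S_0 \<open>0 \<le> A\<close> mult_nonneg_nonneg[OF \<open>0 \<le> B\<close>, of t] by auto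
    moreover have "0 \<le> N" using N[of 0] \<open>0 < \<tau>\<close> by auto
    ultimately show ?thesis by auto
  qed
  then have "\<forall>y\<in>X ` {0..<\<tau>}. norm y \<le> \<bar>x\<bar> + N" by auto
  then show ?thesis unfolding bounded_iff by blast
qed

theorem proposition2p6:
  fixes b g X :: "real \<Rightarrow> real" and A B :: real and T :: ereal
  assumes "\<And>x. 0 \<le> b x"
    and "local_lipschitz (UNIV :: real set) UNIV (\<lambda>_. b)"
    and "mono b"
    and "0 \<le> A" and "0 \<le> B"
    and "continuous_on {0..} g"
    and "Limsup at_top (\<lambda>t::real. INF h\<in>{0..1}. ereal (g (t + h))) = \<infinity>"
    and "maximal_solution b A B g T X"
  shows "blows_up_in_finite_time T \<longleftrightarrow>
    (\<exists>\<alpha>>0. \<exists>\<beta>>0. osgood_integral b \<alpha> \<beta> < \<infinity>)"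
proof
  have b_cont: "continuous_on UNIV b"
    using local_lipschitz_continuous_on[OF assms(2), of 0] by simp
  have pos: "0 < T" and sol: "solves_on b A B g T X"
    and max: "\<And>T' Y. T < T' \<Longrightarrow> solves_on b A B g T' Y \<Longrightarrow> \<not> (\<forall>t\<in>time_interval T. Y t = X t)"
    using assms(8) by (auto simp: maximal_solution_def)
  {
    assume "blows_up_in_finite_time T"
    then obtain \<tau> where \<tau>: "T = ereal \<tau>" "0 < \<tau>"
      using pos by (cases T) (auto simp: blows_up_in_finite_time_def)
    show "\<exists>\<alpha>>0. \<exists>\<beta>>0. osgood_integral b \<alpha> \<beta> < \<infinity>"
    proof (rule ccontr)
      assume "\<not> ?thesis"
      \<comment> \<open>The lower limit used in the bound depends on \<tau> and \<open>g\<close>, so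
        divergence is kept for every positive \<alpha>, with \<beta> fixed to 1.\<close>
      then have "\<not> osgood_integral b \<alpha> 1 < \<infinity>" if "0 < \<alpha>" for \<alpha>
        using that zero_less_one by blast
      then have "bounded (X ` {0..<\<tau>})"
        using finite_time_solution_bounded assms b_cont sol \<tau> by blast
      then obtain X' where X': "continuous_on {0..\<tau>} X'" "\<And>t. t \<in> {0..<\<tau>} \<Longrightarrow> X' t = X t"
        "\<And>t. t \<in> {0..\<tau>} \<Longrightarrow> X' t = A + B * t + integral {0..t} (\<lambda>s. (t - s) * b (X' s)) + g t"
        using bounded_solution_closes[OF b_cont assms(1) \<tau>(2) assms(6)] sol \<tau>(1) by blast
      obtain \<tau>' Y where Y: "\<tau> < \<tau>'" "solves_on b A B g (ereal \<tau>') Y" "\<And>t. t \<in> {0..\<tau>} \<Longrightarrow> Y t = X' t"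
        using closed_solution_extends[OF assms(2) less_imp_le[OF \<tau>(2)] assms(6) X'(1) X'(3)] by blast
      have "\<forall>t\<in>time_interval T. Y t = X t"
        using X'(2) Y(3) by (auto simp: time_interval_def \<tau>(1))
      then show False using max[OF _ Y(2)] Y(1) \<tau>(1) by simp
    qed
  next
    assume "\<exists>\<alpha>>0. \<exists>\<beta>>0. osgood_integral b \<alpha> \<beta> < \<infinity>"
    then obtain \<alpha> \<beta> where fin: "0 < \<beta>" "osgood_integral b \<alpha> \<beta> < \<infinity>" by blast
    obtain G \<Phi> where "osgood b G \<Phi> \<alpha> \<beta>" using osgood_exists[OF assms(1) b_cont fin(1)] by blast
    then have "T \<noteq> \<infinity>"
      using osgood.no_global_solution b_cont assms(3-5,7) sol fin(2) by metis
    then show "blows_up_in_finite_time T" by (simp add: blows_up_in_finite_time_def top.not_eq_extremum)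
  }
qed

end
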